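(* Suppose $0<\kappa_1=\dots=\kappa_{f_1}<\kappa_{f_1+1}=\dots=\kappa_f=\kappa_1/\rho_f<\infty$, where these two values do not vary with $m$, put $f_2=f-f_1$, and suppose $f_1/m\to\bar f_1$ and $f_2/m\to\bar f_2$ as $m\to\infty$ with $\bar f_1+\bar f_2>\bar f_1>0$. Then the equation $$\psi^2-\psi\Bigl(1+\frac{1}{1-\rho_f}\bar f_1+\frac{\rho_f}{1-\rho_f}\bar f_2\Bigr)+\frac{\rho_f}{1-\rho_f}\bar f_2=0$$ has a unique solution $\psi\in\bigl(0,\ \bar f_2\frac{\rho_f}{1-\rho_f}\wedge1\bigr)$, and with this $\psi$, as $m\to\infty$, for every filament $i$, $$\mathbb P[L_i\ge l]\to\Bigl(\rho_i\,\frac{1-\psi}{\bar f_1+1-\psi}\Bigr)^l,\qquad l=0,1,2,\dots,$$ and $m^{-1}M\to0$ in probability.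
   Context: For each $m\in\mathbb N$ consider $m$ monomers and $f=f(m)$ filaments with dissociation constants $\kappa_1,\dots,\kappa_f>0$. $(L_1,\dots,L_f)$ is a random vector of nonnegative integers with $$\mathbb P[L_1=l_1,\dots,L_f=l_f]=c_{m,f}^{-1}\,m!\,\frac{\kappa_1^{-l_1}\cdots\kappa_f^{-l_f}}{(m-l_1-\dots-l_f)!},\qquad l_1+\dots+l_f\le m,$$ where $c_{m,f}$ is the normalization constant, and $M=m-L_1-\dots-L_f$. Here $f_1=f_1(m)$ is the number of filaments with the smallest dissociation constant, and $\rho_i=\kappa_1/\kappa_i$, so $\rho_i=1$ for $i\le f_1$ and $\rho_i=\rho_f\in(0,1)$ for $i>f_1$. As $m\to\infty$, "filament $i$" refers to an index $i=i(m)$ staying in the same one of these two groups. $a\wedge b$ denotes the minimum. *)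

theory Defs
  imports "HOL-Probability.Probability"
begin

text \<open>
  Filaments are indexed by \<open>1, \<dots>, f\<close>.  A configuration assigns to each of them a length
  such that at most \<open>m\<close> monomers are used; it is undefined outside the index set, so that
  each vector of lengths is represented exactly once.
\<close>

definition configs :: "nat \<Rightarrow> nat \<Rightarrow> (nat \<Rightarrow> nat) set" where
  "configs m f = {l \<in> {1..f} \<rightarrow>\<^sub>E UNIV. (\<Sum>i=1..f. l i) \<le> m}"

definition config_weight :: "nat \<Rightarrow> nat \<Rightarrow> (nat \<Rightarrow> real) \<Rightarrow> (nat \<Rightarrow> nat) \<Rightarrow> real" where
  "config_weight m f \<kappa> l =
     fact m * (\<Prod>i=1..f. inverse (\<kappa> i ^ l i)) / fact (m - (\<Sum>i=1..f. l i))"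

definition norm_const :: "nat \<Rightarrow> nat \<Rightarrow> (nat \<Rightarrow> real) \<Rightarrow> real" where
  "norm_const m f \<kappa> = (\<Sum>l\<in>configs m f. config_weight m f \<kappa> l)"

text \<open>
  \<open>L i \<omega>\<close>, for \<open>1 \<le> i \<le> f\<close>, is the length of filament \<open>i\<close>; values of \<open>L\<close> at other indices
  are unconstrained and irrelevant.
\<close>

definition filament_vector ::
  "nat \<Rightarrow> nat \<Rightarrow> (nat \<Rightarrow> real) \<Rightarrow> 'a measure \<Rightarrow> (nat \<Rightarrow> 'a \<Rightarrow> nat) \<Rightarrow> bool" where
  "filament_vector m f \<kappa> \<Omega> L \<longleftrightarrow>
     prob_space \<Omega> \<and>
     (\<forall>i\<in>{1..f}. L i \<in> measurable \<Omega> (count_space UNIV)) \<and>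
     (\<forall>l. (\<Sum>i=1..f. l i) \<le> m \<longrightarrow>
        measure \<Omega> {\<omega> \<in> space \<Omega>. \<forall>i\<in>{1..f}. L i \<omega> = l i}
          = config_weight m f \<kappa> l / norm_const m f \<kappa>)"

definition free_monomers :: "nat \<Rightarrow> nat \<Rightarrow> (nat \<Rightarrow> 'a \<Rightarrow> nat) \<Rightarrow> 'a \<Rightarrow> real" where
  "free_monomers m f L \<omega> = real m - (\<Sum>i=1..f. real (L i \<omega>))"

definition rel_const :: "(nat \<Rightarrow> real) \<Rightarrow> nat \<Rightarrow> real" where
  "rel_const \<kappa> i = \<kappa> 1 / \<kappa> i"

text \<open>The \<open>n\<close>-th random variable may live on its own probability space.\<close>

definition tendsto_in_prob :: "(nat \<Rightarrow> 'a measure) \<Rightarrow> (nat \<Rightarrow> 'a \<Rightarrow> real) \<Rightarrow> real \<Rightarrow> bool" where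
  "tendsto_in_prob \<Omega> X c \<longleftrightarrow>
     (\<forall>\<epsilon>>0. (\<lambda>n. measure (\<Omega> n) {\<omega> \<in> space (\<Omega> n). \<bar>X n \<omega> - c\<bar> > \<epsilon>}) \<longlonglongrightarrow> 0)"

lemma finite_configs: "finite (configs m f)"
proof (rule finite_subset)
  show "configs m f \<subseteq> {1..f} \<rightarrow>\<^sub>E {..m}"
  proof
    fix l assume l: "l \<in> configs m f"
    have "l i \<le> m" if "i \<in> {1..f}" for i
    proof -
      have "l i \<le> (\<Sum>i=1..f. l i)" by (rule member_le_sum) (use that in auto)
      then show ?thesis using l by (auto simp: configs_def)
    qed
    then show "l \<in> {1..f} \<rightarrow>\<^sub>E {..m}" using l by (auto simp: configs_def PiE_iff)
  qed
qed (auto intro: finite_PiE)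

lemma config_weight_pos:
  assumes "\<And>i. i \<in> {1..f} \<Longrightarrow> \<kappa> i > 0"
  shows "config_weight m f \<kappa> l > 0"
  unfolding config_weight_def using assms
  by (intro divide_pos_pos mult_pos_pos prod_pos) auto

lemma norm_const_pos:
  assumes "\<And>i. i \<in> {1..f} \<Longrightarrow> \<kappa> i > 0"
  shows "norm_const m f \<kappa> > 0"
proof -
  have "(\<lambda>i\<in>{1..f}. 0) \<in> configs m f" by (auto simp: configs_def)
  then show ?thesis
    unfolding norm_const_def using config_weight_pos[of f \<kappa> m] assms finite_configs
    by (intro sum_pos) auto
qed

lemma filament_vector_exists:
  assumes pos: "\<And>i. i \<in> {1..f} \<Longrightarrow> \<kappa> i > 0"
  shows "\<exists>\<Omega> :: (nat \<Rightarrow> nat) measure. filament_vector m f \<kappa> \<Omega> (\<lambda>i \<omega>. \<omega> i)"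
proof -
  let ?p = "\<lambda>l. if l \<in> configs m f then config_weight m f \<kappa> l / norm_const m f \<kappa> else 0"
  have c: "norm_const m f \<kappa> > 0" using norm_const_pos pos by blast
  have w: "config_weight m f \<kappa> l > 0" for l using config_weight_pos pos by blast
  have nn: "?p l \<ge> 0" for l using c w[of l] by auto
  have "(\<integral>\<^sup>+l. ennreal (?p l) \<partial>count_space UNIV) = (\<Sum>l\<in>configs m f. ennreal (?p l))"
    by (rule nn_integral_count_space') (auto simp: finite_configs)
  also have "\<dots> = ennreal (\<Sum>l\<in>configs m f. ?p l)" by (rule sum_ennreal) (rule nn)
  also have "(\<Sum>l\<in>configs m f. ?p l) = 1"
    using c by (simp add: sum_divide_distrib[symmetric] norm_const_def[symmetric])
  finally have int: "(\<integral>\<^sup>+l. ennreal (?p l) \<partial>count_space UNIV) = 1" by simp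
  define P where "P = embed_pmf ?p"
  have P: "pmf P l = ?p l" for l unfolding P_def by (rule pmf_embed_pmf[OF nn int])
  have "measure (measure_pmf P) {\<omega>. \<forall>i\<in>{1..f}. \<omega> i = l i}
          = config_weight m f \<kappa> l / norm_const m f \<kappa>" if l: "(\<Sum>i=1..f. l i) \<le> m" for l
  proof -
    let ?l = "restrict l {1..f}"
    have mem: "?l \<in> configs m f" using l by (auto simp: configs_def)
    have "measure (measure_pmf P) {\<omega>. \<forall>i\<in>{1..f}. \<omega> i = l i} = measure (measure_pmf P) {?l}"
    proof (rule measure_pmf.finite_measure_eq_AE)
      have "\<omega> \<in> configs m f" if "\<omega> \<in> set_pmf P" for \<omega>
        using that P[of \<omega>] by (auto simp: set_pmf_iff split: if_splits)
      then show "AE \<omega> in measure_pmf P.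
          (\<omega> \<in> {\<omega>. \<forall>i\<in>{1..f}. \<omega> i = l i}) = (\<omega> \<in> {?l})"
        by (auto simp: AE_measure_pmf_iff configs_def PiE_iff extensional_def fun_eq_iff
            restrict_def split: if_splits)
    qed auto
    also have "\<dots> = ?p ?l" by (simp add: measure_pmf_single P)
    also have "\<dots> = config_weight m f \<kappa> l / norm_const m f \<kappa>"
      using mem by (simp add: config_weight_def)
    finally show ?thesis .
  qed
  then have "filament_vector m f \<kappa> (measure_pmf P) (\<lambda>i \<omega>. \<omega> i)"
    by (simp add: filament_vector_def measure_pmf.prob_space_axioms)
  then show ?thesis by blast
qed

end

theory Submission
  imports Defs
begin

text \<open>
  Write \<open>Z n\<close> for the partition function with \<open>n\<close> monomers, i.e. \<open>c\<^sub>n\<^sub>,\<^sub>f / n!\<close>.  Removing \<open>j\<close>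
  monomers from filament \<open>i\<close> gives \<open>P(L\<^sub>i \<ge> j) = \<kappa>\<^sub>i\<^bsup>-j\<^esup> Z(m - j) / Z m\<close>, and similarly
  \<open>E M = Z(m - 1) / Z m\<close>, so everything reduces to the limit of \<open>Z(n - 1) / Z n\<close> for
  \<open>n = m - s\<close>.  This ratio is monotone in \<open>n\<close>, since \<open>Z\<close> is a convolution of log-concave
  sequences.  Taking expectations in \<open>M + L\<^sub>1 + \<dots> + L\<^sub>f = n\<close> yields
  \<open>n Z n = Z(n - 1) + (\<Sum>i. \<Sum>j=1..n. \<kappa>\<^sub>i\<^bsup>-j\<^esup> Z(n - j))\<close>; by monotonicity each quotient
  \<open>Z(n - j) / Z n\<close> may be compared with the \<open>j\<close>-th power of a single ratio.  Hence the limit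
  of the ratios is \<open>\<kappa>\<^sub>1 x\<close>, where \<open>F\<^sub>1 x / (1 - x) + F\<^sub>2 \<rho> x / (1 - \<rho> x) = 1\<close>.  The root
  \<open>\<psi>\<close> of the quadratic equation is the second summand.
\<close>

section \<open>Partition function and its recursions\<close>

text \<open>Without the factor \<open>fact n\<close> of \<open>config_weight\<close>, the number of
  monomers enters only through the number of free ones. Lowering \<open>n\<close> and one filament
  by the same amount therefore leaves the factorial unchanged.\<close>

definition red_weight :: "nat \<Rightarrow> nat \<Rightarrow> (nat \<Rightarrow> real) \<Rightarrow> (nat \<Rightarrow> nat) \<Rightarrow> real" where
  "red_weight n f \<kappa> l = (\<Prod>i=1..f. inverse (\<kappa> i ^ l i)) / fact (n - (\<Sum>i=1..f. l i))"

text \<open>This is the coefficient of \<open>t^n\<close> in the generating function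
  \<open>exp t * (\<Prod>i=1..f. 1 / (1 - t / \<kappa> i))\<close>.\<close>

definition partition_fun :: "nat \<Rightarrow> (nat \<Rightarrow> real) \<Rightarrow> nat \<Rightarrow> real" where
  "partition_fun f \<kappa> n = (\<Sum>l\<in>configs n f. red_weight n f \<kappa> l)"

lemma config_weight_eq: "config_weight n f \<kappa> l = fact n * red_weight n f \<kappa> l"
  by (simp add: config_weight_def red_weight_def)

lemma norm_const_eq: "norm_const n f \<kappa> = fact n * partition_fun f \<kappa> n"
  by (simp add: norm_const_def partition_fun_def config_weight_eq sum_distrib_left)

lemma partition_fun_pos:
  assumes "\<And>i. i \<in> {1..f} \<Longrightarrow> \<kappa> i > 0"
  shows "partition_fun f \<kappa> n > 0"
  using norm_const_pos[of f \<kappa> n, OF assms] by (simp add: norm_const_eq zero_less_mult_iff)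

text \<open>Lengthening filament \<open>i\<close> by \<open>j\<close> is a bijection from
  \<open>configs (n - j) f\<close> onto the configurations in the sum. It keeps the number of free
  monomers and multiplies the product by \<open>inverse (\<kappa> i ^ j)\<close>.\<close>

lemma sum_red_weight_ge:
  assumes i: "i \<in> {1..f}" and j: "j \<le> n"
  shows "(\<Sum>l | l \<in> configs n f \<and> j \<le> l i. red_weight n f \<kappa> l)
           = inverse (\<kappa> i ^ j) * partition_fun f \<kappa> (n - j)"
proof -
  let ?s = "\<lambda>l::nat \<Rightarrow> nat. l(i := l i + j)"
  have sum_s: "(\<Sum>k=1..f. ?s l k) = (\<Sum>k=1..f. l k) + j" for l
    using i by (subst (1 2) sum.remove[of _ i]) (auto intro!: sum.cong)
  have prod_s: "(\<Prod>k=1..f. inverse (\<kappa> k ^ ?s l k))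
      = inverse (\<kappa> i ^ j) * (\<Prod>k=1..f. inverse (\<kappa> k ^ l k))" for l
  proof -
    have "(\<Prod>k=1..f. inverse (\<kappa> k ^ ?s l k))
        = inverse (\<kappa> i ^ (l i + j)) * (\<Prod>k\<in>{1..f} - {i}. inverse (\<kappa> k ^ l k))"
      using i by (subst prod.remove[of _ i]) (auto intro!: prod.cong)
    also have "\<dots> = inverse (\<kappa> i ^ j) * (\<Prod>k=1..f. inverse (\<kappa> k ^ l k))"
      using i by (subst prod.remove[of "{1..f}" i]) (auto simp: power_add)
    finally show ?thesis .
  qed
  have "(\<Sum>l | l \<in> configs n f \<and> j \<le> l i. red_weight n f \<kappa> l)
      = (\<Sum>l\<in>configs (n - j) f. red_weight n f \<kappa> (?s l))"
  proof (rule sum.reindex_bij_witness[of _ ?s "\<lambda>l. l(i := l i - j)"])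
    fix l assume l: "l \<in> {l \<in> configs n f. j \<le> l i}"
    then have "?s (l(i := l i - j)) = l" by auto
    then have "(\<Sum>k=1..f. l k) = (\<Sum>k=1..f. (l(i := l i - j)) k) + j"
      using sum_s[of "l(i := l i - j)"] by simp
    moreover have "(\<Sum>k=1..f. l k) \<le> n"
      using l by (simp add: configs_def)
    ultimately have "(\<Sum>k=1..f. (l(i := l i - j)) k) \<le> n - j"
      by linarith
    moreover have "l(i := l i - j) \<in> {1..f} \<rightarrow>\<^sub>E UNIV"
      using l i by (auto simp: configs_def PiE_iff extensional_def)
    ultimately show "l(i := l i - j) \<in> configs (n - j) f"
      unfolding configs_def by blast
  next
    fix l assume l: "l \<in> configs (n - j) f"
    have "(\<Sum>k=1..f. l k) \<le> n - j" using l by (simp add: configs_def)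
    then have "(\<Sum>k=1..f. ?s l k) \<le> n" unfolding sum_s using j by linarith
    moreover have "?s l \<in> {1..f} \<rightarrow>\<^sub>E UNIV"
      using l i by (auto simp: configs_def PiE_iff extensional_def)
    ultimately show "?s l \<in> {l \<in> configs n f. j \<le> l i}"
      unfolding configs_def by auto
  qed auto
  also have "\<dots> = (\<Sum>l\<in>configs (n - j) f. inverse (\<kappa> i ^ j) * red_weight (n - j) f \<kappa> l)"
    unfolding red_weight_def prod_s sum_s by (intro sum.cong) (auto simp: algebra_simps)
  finally show ?thesis by (simp add: partition_fun_def sum_distrib_left)
qed

text \<open>The configurations are split according to whether the last filament is empty. In terms
  of generating functions, a new filament contributes a geometric series as a factor.\<close>

lemma partition_fun_Suc_filament:
  "partition_fun (Suc f) \<kappa> n = partition_fun f \<kappa> n +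
     (if n = 0 then 0 else inverse (\<kappa> (Suc f)) * partition_fun (Suc f) \<kappa> (n - 1))"
proof -
  have split: "configs n (Suc f) = {l \<in> configs n (Suc f). 1 \<le> l (Suc f)} \<union>
      {l \<in> configs n (Suc f). l (Suc f) = 0}" by auto
  \<comment> \<open>Configurations are \<open>undefined\<close> outside the index set, so removing
    an empty last filament changes its value from 0 to \<open>undefined\<close>.\<close>
  have "(\<Sum>l | l \<in> configs n (Suc f) \<and> l (Suc f) = 0. red_weight n (Suc f) \<kappa> l)
      = partition_fun f \<kappa> n" unfolding partition_fun_def
    by (rule sum.reindex_bij_witness[of _ "\<lambda>l. l(Suc f := 0)" "\<lambda>l. l(Suc f := undefined)"])
      (auto simp: configs_def red_weight_def PiE_iff extensional_def fun_eq_iff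
        cong: sum.cong_simp prod.cong_simp)
  moreover have "(\<Sum>l | l \<in> configs n (Suc f) \<and> 1 \<le> l (Suc f). red_weight n (Suc f) \<kappa> l)
      = (if n = 0 then 0 else inverse (\<kappa> (Suc f)) * partition_fun (Suc f) \<kappa> (n - 1))"
  proof (cases "n = 0")
    case True
    then have "{l. l \<in> configs n (Suc f) \<and> 1 \<le> l (Suc f)} = {}"
      by (auto simp: configs_def)
    then show ?thesis using True by (simp only: sum.empty if_True simp_thms)
  next
    case False
    then show ?thesis using sum_red_weight_ge[of "Suc f" "Suc f" 1 n \<kappa>] by simp
  qed
  ultimately show ?thesis
    unfolding partition_fun_def[of "Suc f" \<kappa> n]
    by (subst split, subst sum.union_disjoint) (auto simp: finite_configs)
qed

text \<open>With \<open>k\<close> free monomers, \<open>k / fact k = 1 / fact (k - 1)\<close>, which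
  is the factor for one monomer less. Configurations without free monomers contribute 0.\<close>

lemma sum_red_weight_free:
  "(\<Sum>l\<in>configs (Suc n) f. red_weight (Suc n) f \<kappa> l * real (Suc n - (\<Sum>i=1..f. l i)))
     = partition_fun f \<kappa> n"
proof -
  have "(\<Sum>l\<in>configs (Suc n) f. red_weight (Suc n) f \<kappa> l * real (Suc n - (\<Sum>i=1..f. l i)))
      = (\<Sum>l\<in>configs n f. red_weight (Suc n) f \<kappa> l * real (Suc n - (\<Sum>i=1..f. l i)))"
  proof (rule sum.mono_neutral_right)
    show "\<forall>l\<in>configs (Suc n) f - configs n f.
        red_weight (Suc n) f \<kappa> l * real (Suc n - (\<Sum>i=1..f. l i)) = 0"
    proof
      fix l assume "l \<in> configs (Suc n) f - configs n f"
      then have "Suc n - (\<Sum>i=1..f. l i) = 0" by (auto simp: configs_def)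
      then show "red_weight (Suc n) f \<kappa> l * real (Suc n - (\<Sum>i=1..f. l i)) = 0"
        by (simp only: of_nat_0 mult_zero_right)
    qed
  qed (auto simp: finite_configs, auto simp: configs_def)
  also have "\<dots> = partition_fun f \<kappa> n"
    unfolding partition_fun_def red_weight_def
    by (intro sum.cong) (auto simp: configs_def Suc_diff_le simp del: of_nat_Suc)
  finally show ?thesis .
qed

text \<open>Every configuration satisfies: free monomers plus lengths equal \<open>Suc n\<close>.
  Summing this against the weights, with each length \<open>l i\<close> written as the number of
  \<open>j \<ge> 1\<close> with \<open>j \<le> l i\<close>, reduces all terms to the two preceding
  weighted sums.\<close>

lemma partition_fun_count:
  "real (Suc n) * partition_fun f \<kappa> (Suc n) = partition_fun f \<kappa> n +
     (\<Sum>j=1..Suc n. (\<Sum>i=1..f. inverse (\<kappa> i ^ j)) * partition_fun f \<kappa> (Suc n - j))"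
proof -
  let ?C = "configs (Suc n) f" and ?w = "red_weight (Suc n) f \<kappa>"
  have len: "(\<Sum>l\<in>?C. ?w l * real (l i))
      = (\<Sum>j=1..Suc n. inverse (\<kappa> i ^ j) * partition_fun f \<kappa> (Suc n - j))"
    if i: "i \<in> {1..f}" for i
  proof -
    have layer: "real (l i) = (\<Sum>j=1..Suc n. if j \<le> l i then 1 else 0)" if l: "l \<in> ?C" for l
    proof -
      have "l i \<le> (\<Sum>k=1..f. l k)" using i by (intro member_le_sum) auto
      then have "l i \<le> Suc n" using l by (simp add: configs_def)
      then have "{1..Suc n} \<inter> {j. j \<le> l i} = {1..l i}" by auto
      then show ?thesis by (simp only: sum.If_cases[OF finite_atLeastAtMost]) simp
    qed
    have "(\<Sum>l\<in>?C. ?w l * real (l i)) = (\<Sum>l\<in>?C. \<Sum>j=1..Suc n. if j \<le> l i then ?w l else 0)"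
      by (intro sum.cong refl) (auto simp: layer sum_distrib_left if_distrib
          simp del: sum.cl_ivl_Suc cong: if_cong)
    also have "\<dots> = (\<Sum>j=1..Suc n. \<Sum>l\<in>?C. if j \<le> l i then ?w l else 0)"
      by (rule sum.swap)
    also have "\<dots> = (\<Sum>j=1..Suc n. \<Sum>l | l \<in> ?C \<and> j \<le> l i. ?w l)"
      by (intro sum.cong refl sum.inter_filter[symmetric] finite_configs)
    also have "\<dots> = (\<Sum>j=1..Suc n. inverse (\<kappa> i ^ j) * partition_fun f \<kappa> (Suc n - j))"
      using i by (intro sum.cong refl sum_red_weight_ge) auto
    finally show ?thesis .
  qed
  have "real (Suc n) * partition_fun f \<kappa> (Suc n)
      = (\<Sum>l\<in>?C. ?w l * real (Suc n - (\<Sum>i=1..f. l i)) + (\<Sum>i=1..f. ?w l * real (l i)))"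
    unfolding partition_fun_def sum_distrib_left
  proof (intro sum.cong refl)
    fix l assume "l \<in> ?C"
    then have eq: "real (Suc n) = real (Suc n - (\<Sum>i=1..f. l i)) + (\<Sum>i=1..f. real (l i))"
      by (auto simp: configs_def of_nat_diff simp del: of_nat_Suc)
    show "real (Suc n) * ?w l
        = ?w l * real (Suc n - (\<Sum>i=1..f. l i)) + (\<Sum>i=1..f. ?w l * real (l i))"
      by (subst eq, subst mult.commute) (simp only: distrib_left sum_distrib_left)
  qed
  also have "\<dots> = partition_fun f \<kappa> n + (\<Sum>i=1..f. \<Sum>l\<in>?C. ?w l * real (l i))"
    by (subst sum.swap) (simp only: sum.distrib sum_red_weight_free)
  also have "(\<Sum>i=1..f. \<Sum>l\<in>?C. ?w l * real (l i))
      = (\<Sum>i=1..f. \<Sum>j=1..Suc n. inverse (\<kappa> i ^ j) * partition_fun f \<kappa> (Suc n - j))"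
    by (intro sum.cong refl len)
  also have "\<dots> = (\<Sum>j=1..Suc n. (\<Sum>i=1..f. inverse (\<kappa> i ^ j)) * partition_fun f \<kappa> (Suc n - j))"
    unfolding sum_distrib_right by (rule sum.swap)
  finally show ?thesis .
qed

section \<open>Log-concavity and monotone ratios\<close>

text \<open>The recursion makes \<open>b\<close> the convolution of \<open>a\<close> with the powers
  of \<open>c\<close>. Expanding \<open>b (n + 2)\<close> on the left and one factor
  \<open>b (n + 1)\<close> on the right produces the common term \<open>c * b n * b (n + 1)\<close>,
  so the claim reduces to \<open>cross\<close>.\<close>

lemma geometric_convolution_log_concave:
  fixes a b :: "nat \<Rightarrow> real"
  assumes pos: "\<And>n. a n > 0" and lc: "\<And>n. a n * a (n + 2) \<le> a (n + 1) ^ 2" and c: "c \<ge> 0"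
    and b0: "b 0 = a 0" and bS: "\<And>n. b (Suc n) = a (Suc n) + c * b n"
  shows "b n * b (n + 2) \<le> b (n + 1) ^ 2"
proof -
  have bpos: "b n > 0" for n
    by (induction n) (use pos c in \<open>auto simp: b0 bS intro!: add_pos_nonneg\<close>)
  have cross: "b n * a (n + 2) \<le> b (n + 1) * a (n + 1)" for n
  proof (induction n)
    case 0
    have "b 1 * a 1 = a 1 ^ 2 + c * a 0 * a 1"
      by (simp add: bS b0 power2_eq_square algebra_simps)
    moreover have "c * a 0 * a 1 \<ge> 0"
      using c pos[of 0] pos[of 1] by simp
    ultimately show ?case using lc[of 0] by (simp add: b0)
  next
    case (Suc n)
    \<comment> \<open>The auxiliary positive factor \<open>a (n + 1)\<close> lets log-concavity of
      \<open>a\<close> and the induction hypothesis be chained; it is cancelled afterwards. Adding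
      \<open>c\<close> times the result to log-concavity at \<open>n + 1\<close> gives the
      case.\<close>
    have "(b n * a (n + 3)) * a (n + 1) \<le> b n * a (n + 2) ^ 2"
      using mult_left_mono[OF lc[of "n + 1"], of "b n"] bpos[of n]
      by (simp add: algebra_simps numeral_3_eq_3)
    also have "\<dots> \<le> (b (n + 1) * a (n + 2)) * a (n + 1)"
      using mult_right_mono[OF Suc, of "a (n + 2)"] pos[of "n + 2"]
      by (simp add: power2_eq_square algebra_simps)
    finally have "b n * a (n + 3) \<le> b (n + 1) * a (n + 2)"
      using pos[of "n + 1"] by (rule mult_right_le_imp_le)
    then have "c * (b n * a (n + 3)) \<le> c * (b (n + 1) * a (n + 2))"
      using c by (rule mult_left_mono)
    then show ?case
      using lc[of "n + 1"] by (simp add: bS power2_eq_square algebra_simps numeral_3_eq_3)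
  qed
  have "b n * b (n + 2) = b n * a (n + 2) + c * b n * b (n + 1)"
    by (simp add: bS algebra_simps)
  also have "\<dots> \<le> b (n + 1) * a (n + 1) + c * b n * b (n + 1)"
    using cross by simp
  also have "\<dots> = b (n + 1) ^ 2"
    by (simp add: bS power2_eq_square algebra_simps)
  finally show ?thesis .
qed

text \<open>Induction on the number of filaments: without filaments the sequence is
  \<open>1 / fact n\<close>, and each filament is a geometric convolution, which preserves
  log-concavity.\<close>

lemma partition_fun_log_concave:
  assumes "\<And>i. i \<in> {1..f} \<Longrightarrow> \<kappa> i > 0"
  shows "partition_fun f \<kappa> n * partition_fun f \<kappa> (n + 2) \<le> partition_fun f \<kappa> (n + 1) ^ 2"
  using assms
proof (induction f arbitrary: n)
  case 0
  have "configs n 0 = {\<lambda>_. undefined}" for n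
    by (auto simp: configs_def)
  then have Z: "partition_fun 0 \<kappa> n = 1 / fact n" for n
    by (simp add: partition_fun_def red_weight_def)
  have "fact (n + 1) * fact (n + 1) \<le> (fact n * fact (n + 2) :: real)"
    by (simp add: algebra_simps)
  then have "1 / (fact n * fact (n + 2)) \<le> 1 / (fact (n + 1) * fact (n + 1) :: real)"
    by (intro frac_le) auto
  then show ?case unfolding Z by (simp only: power2_eq_square times_divide_times_eq mult_1)
next
  case (Suc f)
  then have pos: "partition_fun f \<kappa> n > 0" for n
    by (intro partition_fun_pos) auto
  have c: "0 \<le> inverse (\<kappa> (Suc f))" using Suc.prems[of "Suc f"] by simp
  have lc: "partition_fun f \<kappa> n * partition_fun f \<kappa> (n + 2) \<le> partition_fun f \<kappa> (n + 1) ^ 2" for n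
    by (rule Suc.IH) (use Suc.prems in auto)
  have "partition_fun (Suc f) \<kappa> 0 = partition_fun f \<kappa> 0"
    using partition_fun_Suc_filament[of f \<kappa> 0] by simp
  moreover have "partition_fun (Suc f) \<kappa> (Suc n) =
      partition_fun f \<kappa> (Suc n) + inverse (\<kappa> (Suc f)) * partition_fun (Suc f) \<kappa> n" for n
    using partition_fun_Suc_filament[of f \<kappa> "Suc n"] by simp
  ultimately show ?case by (rule geometric_convolution_log_concave[OF pos lc c])
qed

text \<open>The quotient \<open>a n / a (n + j)\<close> telescopes into \<open>j\<close> consecutive
  ratios. Their indices are at most \<open>N\<close>, so each is bounded by the ratio at
  \<open>N\<close>.\<close>

lemma le_power_ratio:
  fixes a :: "nat \<Rightarrow> real"
  assumes pos: "\<And>n. a n > 0" and q: "incseq (\<lambda>n. a n / a (Suc n))"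
    and "n + j \<le> Suc N"
  shows "a n \<le> (a N / a (Suc N)) ^ j * a (n + j)"
  using assms(3)
proof (induction j)
  case (Suc j)
  have "a (n + j) / a (Suc (n + j)) \<le> a N / a (Suc N)"
    using incseqD[OF q, of "n + j" N] Suc.prems by simp
  then have "a (n + j) \<le> a N / a (Suc N) * a (Suc (n + j))"
    using pos[of "Suc (n + j)"] by (simp add: divide_le_eq)
  then have "(a N / a (Suc N)) ^ j * a (n + j)
      \<le> (a N / a (Suc N)) ^ j * (a N / a (Suc N) * a (Suc (n + j)))"
    using pos[of N] pos[of "Suc N"] by (intro mult_left_mono) auto
  with Suc show ?case by (simp add: algebra_simps)
qed simp

text \<open>Same telescoping, now with all indices at least \<open>N\<close>.\<close>

lemma ge_power_ratio:
  fixes a :: "nat \<Rightarrow> real"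
  assumes pos: "\<And>n. a n > 0" and q: "incseq (\<lambda>n. a n / a (Suc n))"
    and "N \<le> n"
  shows "(a N / a (Suc N)) ^ j * a (n + j) \<le> a n"
proof (induction j)
  case (Suc j)
  have "a N / a (Suc N) \<le> a (n + j) / a (Suc (n + j))"
    using incseqD[OF q, of N "n + j"] assms(3) by simp
  then have "a N / a (Suc N) * a (Suc (n + j)) \<le> a (n + j)"
    using pos[of "Suc (n + j)"] by (simp add: le_divide_eq)
  then have "(a N / a (Suc N)) ^ j * (a N / a (Suc N) * a (Suc (n + j)))
      \<le> (a N / a (Suc N)) ^ j * a (n + j)"
    using pos[of N] pos[of "Suc N"] by (intro mult_left_mono) auto
  with Suc show ?case by (simp add: algebra_simps)
qed simp

lemma incseq_partition_fun_ratio: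
  assumes "\<And>i. i \<in> {1..f} \<Longrightarrow> \<kappa> i > 0"
  shows "incseq (\<lambda>n. partition_fun f \<kappa> n / partition_fun f \<kappa> (Suc n))"
proof (rule incseq_SucI)
  fix n
  show "partition_fun f \<kappa> n / partition_fun f \<kappa> (Suc n)
      \<le> partition_fun f \<kappa> (Suc n) / partition_fun f \<kappa> (Suc (Suc n))"
    using partition_fun_log_concave[of f \<kappa> n, OF assms] partition_fun_pos[of f \<kappa>, OF assms]
    by (simp add: field_simps power2_eq_square)
qed

section \<open>Bounds and limit for the ratio\<close>

text \<open>The count identity at \<open>Suc n\<close> involves only ratios of index at most
  \<open>n\<close>, and \<open>q\<close> is the largest of them.\<close>

lemma partition_fun_ratio_upper:
  fixes n :: nat
  assumes pos: "\<And>i. i \<in> {1..f} \<Longrightarrow> \<kappa> i > 0"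
  defines "q \<equiv> partition_fun f \<kappa> n / partition_fun f \<kappa> (Suc n)"
  shows "real (Suc n) \<le> q + (\<Sum>j=1..Suc n. (\<Sum>i=1..f. inverse (\<kappa> i ^ j)) * q ^ j)"
proof -
  let ?Z = "partition_fun f \<kappa>"
  have Z: "?Z n > 0" for n by (rule partition_fun_pos) (rule pos)
  have "real (Suc n) * ?Z (Suc n) \<le> q * ?Z (Suc n) +
      (\<Sum>j=1..Suc n. (\<Sum>i=1..f. inverse (\<kappa> i ^ j)) * (q ^ j * ?Z (Suc n)))"
    unfolding partition_fun_count
  proof (intro add_mono sum_mono mult_left_mono)
    show "?Z n \<le> q * ?Z (Suc n)" using Z[of "Suc n"] by (simp add: q_def)
    show "?Z (Suc n - j) \<le> q ^ j * ?Z (Suc n)" if "j \<in> {1..Suc n}" for j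
      using le_power_ratio[of ?Z "Suc n - j" j n, OF Z incseq_partition_fun_ratio[OF pos]] that
      by (simp add: q_def)
    show "0 \<le> (\<Sum>i=1..f. inverse (\<kappa> i ^ j))" for j
      using pos by (intro sum_nonneg) (simp add: less_imp_le)
  qed
  also have "\<dots> = (q + (\<Sum>j=1..Suc n. (\<Sum>i=1..f. inverse (\<kappa> i ^ j)) * q ^ j)) * ?Z (Suc n)"
    by (simp only: distrib_right sum_distrib_right mult.assoc)
  finally show ?thesis using Z[of "Suc n"] by (rule mult_right_le_imp_le)
qed

text \<open>
  The count identity is applied at \<open>n + K\<close>, so that the ratio at \<open>n\<close> lies below all ratios
  occurring in its first \<open>K\<close> terms.
\<close>

lemma partition_fun_ratio_lower:
  fixes n :: nat
  assumes pos: "\<And>i. i \<in> {1..f} \<Longrightarrow> \<kappa> i > 0" and K: "K > 0"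
  defines "q \<equiv> partition_fun f \<kappa> n / partition_fun f \<kappa> (Suc n)"
  shows "(\<Sum>j=1..K. (\<Sum>i=1..f. inverse (\<kappa> i ^ j)) * q ^ j) \<le> real (n + K)"
proof -
  let ?Z = "partition_fun f \<kappa>"
  obtain K' where K': "K = Suc K'" using K gr0_implies_Suc by blast
  have Z: "?Z n > 0" for n by (rule partition_fun_pos) (rule pos)
  have c: "0 \<le> (\<Sum>i=1..f. inverse (\<kappa> i ^ j))" for j
    using pos by (intro sum_nonneg) (simp add: less_imp_le)
  have "(\<Sum>j=1..K. (\<Sum>i=1..f. inverse (\<kappa> i ^ j)) * q ^ j) * ?Z (n + K)
      = (\<Sum>j=1..K. (\<Sum>i=1..f. inverse (\<kappa> i ^ j)) * (q ^ j * ?Z (n + K)))"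
    by (simp only: sum_distrib_right mult.assoc)
  also have "\<dots> \<le> (\<Sum>j=1..K. (\<Sum>i=1..f. inverse (\<kappa> i ^ j)) * ?Z (n + K - j))"
  proof (intro sum_mono mult_left_mono c)
    fix j assume j: "j \<in> {1..K}"
    then have "n \<le> n + K - j" by auto
    with j show "q ^ j * ?Z (n + K) \<le> ?Z (n + K - j)"
      using ge_power_ratio[of ?Z n "n + K - j" j, OF Z incseq_partition_fun_ratio[OF pos]]
      by (simp add: q_def)
  qed
  \<comment> \<open>The added terms with \<open>j > K\<close>, and in the next step the free-monomer
    term, are positive or zero; together they complete the count identity at
    \<open>n + K\<close>.\<close>
  also have "\<dots> \<le> (\<Sum>j=1..n + K. (\<Sum>i=1..f. inverse (\<kappa> i ^ j)) * ?Z (n + K - j))"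
    by (rule sum_mono2) (auto simp only: finite_atLeastAtMost atLeastatMost_subset_iff
        intro!: mult_nonneg_nonneg c less_imp_le[OF Z])
  also have "\<dots> \<le> real (n + K) * ?Z (n + K)"
    using partition_fun_count[of "n + K'" f \<kappa>] Z[of "n + K'"] by (simp add: K')
  finally show ?thesis using Z[of "n + K"] by (rule mult_right_le_imp_le)
qed

lemma sum_geometric_le:
  fixes z :: real
  assumes "0 \<le> z" "z < 1"
  shows "(\<Sum>j=1..K. z ^ j) \<le> z / (1 - z)"
proof -
  have "(\<Sum>j=1..K. z ^ j) = (z - z ^ Suc K) / (1 - z)"
    using sum_gp[of z 1 K] assms by (cases K) auto
  also have "\<dots> \<le> z / (1 - z)"
    using assms by (intro divide_right_mono) auto
  finally show ?thesis .
qed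

lemma sum_geometric_tendsto:
  fixes z :: real
  assumes "0 \<le> z" "z < 1"
  shows "(\<lambda>K. \<Sum>j=1..K. z ^ j) \<longlonglongrightarrow> z / (1 - z)"
proof -
  have eq: "(\<Sum>j=1..K. z ^ j) = (z - z * z ^ K) / (1 - z)" for K
    using sum_gp[of z 1 K] assms by (cases K) auto
  have "(\<lambda>K. (z - z * z ^ K) / (1 - z)) \<longlonglongrightarrow> (z - z * 0) / (1 - z)"
    using assms by (intro tendsto_intros LIMSEQ_realpow_zero) auto
  then show ?thesis unfolding eq by simp
qed

lemma divide_one_minus_strict_mono:
  fixes y z :: real
  assumes "y < z" "z < 1"
  shows "y / (1 - y) < z / (1 - z)"
  using assms by (simp add: field_simps)

text \<open>A ratio at most \<open>\<kappa>1 * z\<close> with \<open>z < x\<close> would account for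
  too few monomers, and one at least \<open>\<kappa>1 * z\<close> with \<open>z > x\<close> for too
  many. The shift \<open>s\<close> lowers the number of monomers while the filaments remain those
  belonging to \<open>m\<close>, as telescoping will require.\<close>

lemma partition_fun_ratio_limit:
  fixes f1 f2 :: "nat \<Rightarrow> nat" and \<kappa> :: "nat \<Rightarrow> nat \<Rightarrow> real" and \<kappa>1 \<rho> F1 F2 x :: real
  assumes rho: "0 < \<rho>" "\<rho> < 1" and kappa1: "0 < \<kappa>1"
    and kappa_le: "\<And>m i. i \<in> {1..f1 m} \<Longrightarrow> \<kappa> m i = \<kappa>1"
    and kappa_gt: "\<And>m i. i \<in> {f1 m + 1..f1 m + f2 m} \<Longrightarrow> \<kappa> m i = \<kappa>1 / \<rho>"
    and lim1: "(\<lambda>m. real (f1 m) / real m) \<longlonglongrightarrow> F1"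
    and lim2: "(\<lambda>m. real (f2 m) / real m) \<longlonglongrightarrow> F2"
    and F: "F1 > 0" "F2 > 0"
    and x: "0 < x" "x < 1" "F1 * (x / (1 - x)) + F2 * (\<rho> * x / (1 - \<rho> * x)) = 1"
  shows "(\<lambda>m. partition_fun (f1 m + f2 m) (\<kappa> m) (m - Suc s) /
               partition_fun (f1 m + f2 m) (\<kappa> m) (m - s)) \<longlonglongrightarrow> \<kappa>1 * x"
proof -
  define f where "f m = f1 m + f2 m" for m
  \<comment> \<open>\<open>Suc (m - Suc s)\<close> equals \<open>m - s\<close> only when
    \<open>m > s\<close>; this form matches the ratio bounds for every \<open>m\<close>, and the
    difference is removed at the end.\<close>
  define q where "q m = partition_fun (f m) (\<kappa> m) (m - Suc s) /
      partition_fun (f m) (\<kappa> m) (Suc (m - Suc s))" for m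
  \<comment> \<open>\<open>g z\<close> is the limiting share of monomers bound in filaments if all
    ratios were \<open>\<kappa>1 * z\<close>; hence \<open>g x = 1\<close> singles out the
    limit.\<close>
  define g where "g z = F1 * (z / (1 - z)) + F2 * (\<rho> * z / (1 - \<rho> * z))" for z
  have pos: "\<kappa> m i > 0" if "i \<in> {1..f m}" for m i
    using that kappa_le[of i m] kappa_gt[of i m] rho kappa1
    by (cases "i \<le> f1 m") (auto simp: f_def)
  have qpos: "q m > 0" for m
    unfolding q_def using pos by (intro divide_pos_pos partition_fun_pos) auto
  have rz: "0 < \<rho> * z" "\<rho> * z < z" "\<rho> * z < 1" if "0 < z" "z < 1" for z
  proof -
    show "0 < \<rho> * z" using rho that by simp
    show "\<rho> * z < z" using rho that mult_strict_right_mono[of \<rho> 1 z] by simp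
    then show "\<rho> * z < 1" using that by linarith
  qed
  have g_mono: "g y < g z" if "0 < y" "y < z" "z < 1" for y z
    unfolding g_def using F rho rz[of z] that
    by (intro add_strict_mono mult_strict_left_mono divide_one_minus_strict_mono) auto
  have power_sum: "(\<Sum>i=1..f m. inverse (\<kappa> m i ^ j)) * y ^ j
      = (real (f1 m) + real (f2 m) * \<rho> ^ j) * (y / \<kappa>1) ^ j" for m j y
  proof -
    have "(\<Sum>i=1..f m. inverse (\<kappa> m i ^ j))
        = (\<Sum>i=1..f1 m. inverse (\<kappa> m i ^ j)) + (\<Sum>i=f1 m + 1..f1 m + f2 m. inverse (\<kappa> m i ^ j))"
      unfolding f_def by (subst sum.ub_add_nat) auto
    also have "\<dots> = (\<Sum>i=1..f1 m. inverse (\<kappa>1 ^ j)) + (\<Sum>i=f1 m + 1..f1 m + f2 m. inverse ((\<kappa>1 / \<rho>) ^ j))"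
      by (intro arg_cong2[of _ _ _ _ "(+)"] sum.cong refl) (simp_all only: kappa_le kappa_gt)
    finally have sum: "(\<Sum>i=1..f m. inverse (\<kappa> m i ^ j))
        = real (f1 m) * inverse (\<kappa>1 ^ j) + real (f2 m) * inverse ((\<kappa>1 / \<rho>) ^ j)"
      by simp
    show ?thesis unfolding sum using rho kappa1 by (simp add: field_simps)
  qed
  have lower: "\<forall>\<^sub>F m in sequentially. \<kappa>1 * z < q m" if z: "0 < z" "z < x" for z
  proof -
    have z1: "z < 1" using z x by simp
    \<comment> \<open>This is the bound on the monomer count divided by \<open>m\<close>:
      \<open>\<kappa>1 * z\<close> dominates the free-monomer term and \<open>s\<close> makes up for
      having only \<open>m - s\<close> monomers.\<close>
    define h where "h m = real (f1 m) / real m * (z / (1 - z))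
        + real (f2 m) / real m * (\<rho> * z / (1 - \<rho> * z)) + (\<kappa>1 * z + real s) / real m" for m
    have "h \<longlonglongrightarrow> g z + 0" unfolding g_def h_def
      by (intro tendsto_intros lim1 lim2 lim_const_over_n)
    moreover have "g z + 0 < 1" using g_mono[OF z x(2)] x(3) by (simp add: g_def)
    ultimately have "\<forall>\<^sub>F m in sequentially. h m < 1" by (rule order_tendstoD(2))
    then show ?thesis using eventually_gt_at_top[of s]
    proof eventually_elim
      case (elim m)
      show ?case
      proof (rule ccontr)
        assume "\<not> \<kappa>1 * z < q m"
        then have le: "q m \<le> \<kappa>1 * z" by simp
        then have le_pow: "(q m / \<kappa>1) ^ j \<le> z ^ j" for j
          using kappa1 qpos[of m] by (intro power_mono) (auto simp: divide_le_eq mult.commute)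
        have "real (Suc (m - Suc s)) \<le> q m +
            (\<Sum>j=1..Suc (m - Suc s). (\<Sum>i=1..f m. inverse (\<kappa> m i ^ j)) * q m ^ j)"
          unfolding q_def by (rule partition_fun_ratio_upper[OF pos])
        also have "\<dots> \<le> \<kappa>1 * z +
            (\<Sum>j=1..Suc (m - Suc s). (real (f1 m) + real (f2 m) * \<rho> ^ j) * z ^ j)"
          unfolding power_sum using rho by (intro add_mono le sum_mono mult_left_mono le_pow) auto
        also have "\<dots> = \<kappa>1 * z + (real (f1 m) * (\<Sum>j=1..Suc (m - Suc s). z ^ j) +
            real (f2 m) * (\<Sum>j=1..Suc (m - Suc s). (\<rho> * z) ^ j))"
          by (simp only: sum_distrib_left distrib_right sum.distrib power_mult_distrib mult.assoc)
        also have "\<dots> \<le> \<kappa>1 * z + (real (f1 m) * (z / (1 - z)) +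
            real (f2 m) * (\<rho> * z / (1 - \<rho> * z)))"
          using z z1 rz[OF z(1) z1]
          by (intro add_mono mult_left_mono sum_geometric_le order_refl) auto
        also have "\<dots> = h m * real m - real s"
        proof -
          have clear: "(a / t * y + b / t * y' + c / t) * t = a * y + b * y' + c"
            if "t \<noteq> 0" for a b c t y y' :: real
            using that by (simp add: field_simps)
          show ?thesis unfolding h_def by (subst clear) (use elim in simp_all)
        qed
        finally have "real m \<le> h m * real m" using elim by (simp add: of_nat_diff)
        then show False using elim by (simp add: mult_le_cancel_right1 not_le)
      qed
    qed
  qed
  have upper: "\<forall>\<^sub>F m in sequentially. q m < \<kappa>1 * z" if z: "x < z" "z < 1" for z
  proof -
    have z0: "0 < z" using z x by simp
    \<comment> \<open>The lower count bound only controls finitely many terms, at the cost of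
      \<open>K\<close> extra monomers. A fixed \<open>K\<close> for which the truncated sum already
      exceeds 1 suffices, because \<open>K / m\<close> vanishes.\<close>
    have "(\<lambda>K. F1 * (\<Sum>j=1..K. z ^ j) + F2 * (\<Sum>j=1..K. (\<rho> * z) ^ j)) \<longlonglongrightarrow> g z"
      unfolding g_def using z z0 rz[OF z0 z(2)]
      by (intro tendsto_intros sum_geometric_tendsto) auto
    moreover have "1 < g z" using g_mono[OF x(1) z] x(3) by (simp add: g_def)
    ultimately have "\<forall>\<^sub>F K in sequentially.
        1 < F1 * (\<Sum>j=1..K. z ^ j) + F2 * (\<Sum>j=1..K. (\<rho> * z) ^ j)"
      by (rule order_tendstoD(1))
    then have "\<forall>\<^sub>F K in sequentially. K > 0 \<and>
        1 < F1 * (\<Sum>j=1..K. z ^ j) + F2 * (\<Sum>j=1..K. (\<rho> * z) ^ j)"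
      using eventually_gt_at_top[of 0] by eventually_elim simp
    then obtain K where K: "K > 0"
        "1 < F1 * (\<Sum>j=1..K. z ^ j) + F2 * (\<Sum>j=1..K. (\<rho> * z) ^ j)"
      using eventually_happens'[OF sequentially_bot] by blast
    define h where "h m = real (f1 m) / real m * (\<Sum>j=1..K. z ^ j)
        + real (f2 m) / real m * (\<Sum>j=1..K. (\<rho> * z) ^ j) - real K / real m" for m
    have "h \<longlonglongrightarrow> F1 * (\<Sum>j=1..K. z ^ j) + F2 * (\<Sum>j=1..K. (\<rho> * z) ^ j) - 0"
      unfolding h_def by (intro tendsto_intros lim1 lim2 lim_const_over_n)
    then have "\<forall>\<^sub>F m in sequentially. 1 < h m"
      by (rule order_tendstoD(1)) (use K in simp)
    then show ?thesis using eventually_gt_at_top[of s]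
    proof eventually_elim
      case (elim m)
      show ?case
      proof (rule ccontr)
        assume "\<not> q m < \<kappa>1 * z"
        then have le: "\<kappa>1 * z \<le> q m" by simp
        then have ge: "z ^ j \<le> (q m / \<kappa>1) ^ j" for j
          using kappa1 z0 by (intro power_mono) (auto simp: le_divide_eq mult.commute)
        have "h m * real m + real K
            = (\<Sum>j=1..K. (real (f1 m) + real (f2 m) * \<rho> ^ j) * z ^ j)"
        proof -
          have "h m * real m + real K = real (f1 m) * (\<Sum>j=1..K. z ^ j)
              + real (f2 m) * (\<Sum>j=1..K. (\<rho> * z) ^ j)"
            using elim by (simp add: h_def field_simps)
          then show ?thesis
            by (simp only: sum_distrib_left distrib_right sum.distrib power_mult_distrib mult.assoc)
        qed
        also have "\<dots> \<le> (\<Sum>j=1..K. (real (f1 m) + real (f2 m) * \<rho> ^ j) * (q m / \<kappa>1) ^ j)"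
          using rho by (intro sum_mono mult_left_mono ge) auto
        also have "\<dots> = (\<Sum>j=1..K. (\<Sum>i=1..f m. inverse (\<kappa> m i ^ j)) * q m ^ j)"
          by (simp only: power_sum)
        also have "\<dots> \<le> real (m - Suc s + K)"
          unfolding q_def by (rule partition_fun_ratio_lower[OF pos K(1)])
        also have "\<dots> \<le> real m + real K" by simp
        finally have "h m * real m \<le> real m" by simp
        then show False using elim by (simp add: mult_le_cancel_right2 not_le)
      qed
    qed
  qed
  have "q \<longlonglongrightarrow> \<kappa>1 * x"
  proof (rule order_tendstoI)
    fix a assume a: "a < \<kappa>1 * x"
    \<comment> \<open>The maximum with \<open>x / 2\<close> keeps the comparison point positive even
      if \<open>a \<le> 0\<close>; below, the minimum with \<open>(1 + x) / 2\<close> keeps it under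
      1.\<close>
    have "max (a / \<kappa>1) (x / 2) < x" "0 < max (a / \<kappa>1) (x / 2)"
      using a kappa1 x by (auto simp: divide_less_eq mult.commute less_max_iff_disj)
    from lower[OF this(2,1)] show "\<forall>\<^sub>F m in sequentially. a < q m"
    proof eventually_elim
      case (elim m)
      have "a = \<kappa>1 * (a / \<kappa>1)" using kappa1 by simp
      also have "\<dots> \<le> \<kappa>1 * max (a / \<kappa>1) (x / 2)"
        using kappa1 by (intro mult_left_mono) auto
      finally show ?case using elim by simp
    qed
  next
    fix a assume a: "\<kappa>1 * x < a"
    have "x < min (a / \<kappa>1) ((1 + x) / 2)" "min (a / \<kappa>1) ((1 + x) / 2) < 1"
      using a kappa1 x by (auto simp: less_divide_eq mult.commute min_less_iff_disj)
    from upper[OF this] show "\<forall>\<^sub>F m in sequentially. q m < a"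
    proof eventually_elim
      case (elim m)
      have "\<kappa>1 * min (a / \<kappa>1) ((1 + x) / 2) \<le> \<kappa>1 * (a / \<kappa>1)"
        using kappa1 by (intro mult_left_mono) auto
      also have "\<dots> = a" using kappa1 by simp
      finally show ?case using elim by simp
    qed
  qed
  moreover have "\<forall>\<^sub>F m in sequentially. q m =
      partition_fun (f1 m + f2 m) (\<kappa> m) (m - Suc s) /
      partition_fun (f1 m + f2 m) (\<kappa> m) (m - s)"
    using eventually_gt_at_top[of s]
    by eventually_elim (simp add: q_def f_def Suc_diff_Suc)
  ultimately show ?thesis by (rule Lim_transform_eventually)
qed

text \<open>The quotient telescopes into \<open>l\<close> ratios with fixed shifts
  \<open>s < l\<close>, each tending to \<open>c\<close>.\<close>

lemma tendsto_power_ratio: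
  fixes a :: "nat \<Rightarrow> nat \<Rightarrow> real"
  assumes nz: "\<And>m n. a m n \<noteq> 0"
    and lim: "\<And>s. (\<lambda>m. a m (m - Suc s) / a m (m - s)) \<longlonglongrightarrow> c"
  shows "(\<lambda>m. a m (m - l) / a m m) \<longlonglongrightarrow> c ^ l"
proof (induction l)
  case 0
  then show ?case using nz by simp
next
  case (Suc l)
  have "(\<lambda>m. a m (m - Suc l) / a m (m - l) * (a m (m - l) / a m m)) \<longlonglongrightarrow> c * c ^ l"
    by (intro tendsto_mult lim Suc)
  then show ?case using nz by simp
qed

section \<open>Probabilities in terms of the partition function\<close>

text \<open>\<open>filament_vector\<close> prescribes point masses on \<open>configs\<close> only.
  They add up to 1, so the lengths lie in \<open>configs\<close> almost surely and every event
  reduces to a finite sum.\<close>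

lemma filament_vector_measure:
  assumes fv: "filament_vector m f \<kappa> \<Omega> L"
    and pos: "\<And>i. i \<in> {1..f} \<Longrightarrow> \<kappa> i > 0"
    and E: "{\<omega> \<in> space \<Omega>. P (\<lambda>i\<in>{1..f}. L i \<omega>)} \<in> sets \<Omega>"
  shows "measure \<Omega> {\<omega> \<in> space \<Omega>. P (\<lambda>i\<in>{1..f}. L i \<omega>)}
    = (\<Sum>l | l \<in> configs m f \<and> P l. red_weight m f \<kappa> l) / partition_fun f \<kappa> m"
proof -
  interpret prob_space \<Omega> using fv by (simp add: filament_vector_def)
  have [measurable]: "L i \<in> measurable \<Omega> (count_space UNIV)" if "i \<in> {1..f}" for i
    using fv that by (simp add: filament_vector_def)
  define A where "A l = {\<omega> \<in> space \<Omega>. \<forall>i\<in>{1..f}. L i \<omega> = l i}" for l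
  have A [measurable]: "A l \<in> sets \<Omega>" for l
    unfolding A_def by measurable
  have A_eq: "A l = {\<omega> \<in> space \<Omega>. (\<lambda>i\<in>{1..f}. L i \<omega>) = l}" if "l \<in> configs m f" for l
    using that by (auto simp: A_def configs_def PiE_iff extensional_def fun_eq_iff)
  have disj: "disjoint_family_on A (configs m f)"
    by (auto simp: disjoint_family_on_def A_eq)
  have A_prob: "prob (A l) = red_weight m f \<kappa> l / partition_fun f \<kappa> m" if "l \<in> configs m f" for l
    using fv that unfolding filament_vector_def A_def
    by (simp add: configs_def config_weight_eq norm_const_eq)
  have union: "prob (\<Union>l\<in>C. A l) = (\<Sum>l\<in>C. red_weight m f \<kappa> l) / partition_fun f \<kappa> m"
    if C: "C \<subseteq> configs m f" for C
  proof -
    have "prob (\<Union>l\<in>C. A l) = (\<Sum>l\<in>C. prob (A l))"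
      using C disj finite_subset[OF C finite_configs]
      by (intro finite_measure_finite_Union) (auto simp: disjoint_family_on_def)
    also have "\<dots> = (\<Sum>l\<in>C. red_weight m f \<kappa> l / partition_fun f \<kappa> m)"
      using C A_prob by (intro sum.cong) auto
    finally show ?thesis by (simp add: sum_divide_distrib)
  qed
  have "prob (\<Union>l\<in>configs m f. A l) = 1"
    using union[of "configs m f"] partition_fun_pos[of f \<kappa> m, OF pos]
    by (simp add: partition_fun_def)
  then have "AE \<omega> in \<Omega>. \<omega> \<in> (\<Union>l\<in>configs m f. A l)"
    by (subst (asm) prob_eq_1) (auto simp: finite_configs)
  then have "prob {\<omega> \<in> space \<Omega>. P (\<lambda>i\<in>{1..f}. L i \<omega>)}
      = prob (\<Union>l\<in>{l \<in> configs m f. P l}. A l)"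
  proof (intro finite_measure_eq_AE E)
    show "(\<Union>l\<in>{l \<in> configs m f. P l}. A l) \<in> sets \<Omega>"
      using finite_configs by (intro sets.finite_UN) auto
    assume "AE \<omega> in \<Omega>. \<omega> \<in> (\<Union>l\<in>configs m f. A l)"
    then show "AE \<omega> in \<Omega>. (\<omega> \<in> {\<omega> \<in> space \<Omega>. P (\<lambda>i\<in>{1..f}. L i \<omega>)})
        = (\<omega> \<in> (\<Union>l\<in>{l \<in> configs m f. P l}. A l))"
      by eventually_elim (auto simp: A_eq)
  qed
  also have "\<dots> = (\<Sum>l | l \<in> configs m f \<and> P l. red_weight m f \<kappa> l) / partition_fun f \<kappa> m"
    by (rule union) auto
  finally show ?thesis .
qed

lemma prob_filament_ge:
  assumes fv: "filament_vector m f \<kappa> \<Omega> L"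
    and pos: "\<And>i. i \<in> {1..f} \<Longrightarrow> \<kappa> i > 0" and i: "i \<in> {1..f}" and j: "j \<le> m"
  shows "measure \<Omega> {\<omega> \<in> space \<Omega>. L i \<omega> \<ge> j}
    = inverse (\<kappa> i ^ j) * (partition_fun f \<kappa> (m - j) / partition_fun f \<kappa> m)"
proof -
  have [measurable]: "L i \<in> measurable \<Omega> (count_space UNIV)"
    using fv i by (simp add: filament_vector_def)
  have "{\<omega> \<in> space \<Omega>. j \<le> L i \<omega>} \<in> sets \<Omega>" by measurable
  then show ?thesis
    using filament_vector_measure[OF fv pos, of "\<lambda>l. j \<le> l i"] sum_red_weight_ge[OF i j, of \<kappa>] i
    by simp
qed

text \<open>Markov's inequality, carried out on the weights; the mean number of free monomers is
  given by \<open>sum_red_weight_free\<close>.\<close>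

lemma prob_free_monomers_gt:
  assumes fv: "filament_vector (Suc n) f \<kappa> \<Omega> L"
    and pos: "\<And>i. i \<in> {1..f} \<Longrightarrow> \<kappa> i > 0" and c: "c > 0"
  shows "measure \<Omega> {\<omega> \<in> space \<Omega>. \<bar>free_monomers (Suc n) f L \<omega>\<bar> > c}
    \<le> partition_fun f \<kappa> n / partition_fun f \<kappa> (Suc n) / c"
proof -
  let ?C = "configs (Suc n) f" and ?w = "red_weight (Suc n) f \<kappa>" and ?Z = "partition_fun f \<kappa>"
  let ?P = "\<lambda>l. \<bar>real (Suc n) - (\<Sum>i=1..f. real (l i))\<bar> > c"
  have [measurable]: "L i \<in> measurable \<Omega> (count_space UNIV)" if "i \<in> {1..f}" for i
    using fv that by (simp add: filament_vector_def)
  have Z: "?Z n > 0" for n by (rule partition_fun_pos) (rule pos)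
  have w: "?w l \<ge> 0" for l
    unfolding red_weight_def using pos
    by (intro divide_nonneg_nonneg prod_nonneg) (auto simp: less_imp_le)
  have P_eq: "?P (\<lambda>i\<in>{1..f}. L i \<omega>) \<longleftrightarrow> \<bar>free_monomers (Suc n) f L \<omega>\<bar> > c" for \<omega>
    by (simp add: free_monomers_def)
  have "{\<omega> \<in> space \<Omega>. \<bar>free_monomers (Suc n) f L \<omega>\<bar> > c} \<in> sets \<Omega>"
    unfolding free_monomers_def by measurable
  then have "measure \<Omega> {\<omega> \<in> space \<Omega>. \<bar>free_monomers (Suc n) f L \<omega>\<bar> > c}
      = (\<Sum>l | l \<in> ?C \<and> ?P l. ?w l) / ?Z (Suc n)"
    using filament_vector_measure[OF fv pos, of ?P] unfolding P_eq by simp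
  also have "\<dots> \<le> (\<Sum>l\<in>?C. ?w l * real (Suc n - (\<Sum>i=1..f. l i)) / c) / ?Z (Suc n)"
  proof (intro divide_right_mono)
    have "(\<Sum>l | l \<in> ?C \<and> ?P l. ?w l)
        \<le> (\<Sum>l | l \<in> ?C \<and> ?P l. ?w l * real (Suc n - (\<Sum>i=1..f. l i)) / c)"
    proof (rule sum_mono)
      fix l assume l: "l \<in> {l. l \<in> ?C \<and> ?P l}"
      then have le: "(\<Sum>i=1..f. l i) \<le> Suc n" by (simp add: configs_def)
      then have "real (Suc n - (\<Sum>i=1..f. l i)) = \<bar>real (Suc n) - (\<Sum>i=1..f. real (l i))\<bar>"
        using of_nat_mono[OF le, where 'a = real] by (simp add: of_nat_diff del: of_nat_Suc)
      then have "c \<le> real (Suc n - (\<Sum>i=1..f. l i))" using l by simp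
      then show "?w l \<le> ?w l * real (Suc n - (\<Sum>i=1..f. l i)) / c"
        using mult_left_mono[OF _ w, of c "real (Suc n - (\<Sum>i=1..f. l i))" l] c
        by (simp only: pos_le_divide_eq)
    qed
    also have "\<dots> \<le> (\<Sum>l\<in>?C. ?w l * real (Suc n - (\<Sum>i=1..f. l i)) / c)"
      using w c by (intro sum_mono2) (auto simp: finite_configs)
    finally show "(\<Sum>l | l \<in> ?C \<and> ?P l. ?w l)
        \<le> (\<Sum>l\<in>?C. ?w l * real (Suc n - (\<Sum>i=1..f. l i)) / c)" .
  qed (use Z[of "Suc n"] in simp)
  also have "\<dots> = ?Z n / ?Z (Suc n) / c"
    unfolding sum_divide_distrib[symmetric] sum_red_weight_free by simp
  finally show ?thesis .
qed

section \<open>The quadratic equation\<close>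

text \<open>The polynomial is \<open>B > 0\<close> at 0, while its values \<open>- (A * B)\<close>
  at \<open>B\<close> and \<open>- A\<close> at 1 are negative, so it changes sign on the
  interval.\<close>

lemma quadratic_unique_root:
  fixes A B :: real
  assumes "A > 0" "B > 0"
  shows "\<exists>!\<psi>. \<psi> \<in> {0<..<min B 1} \<and> \<psi>\<^sup>2 - \<psi> * (1 + A + B) + B = 0"
proof -
  define p where "p t = t\<^sup>2 - t * (1 + A + B) + B" for t
  define c where "c = min B 1"
  have c: "c > 0" using assms by (simp add: c_def)
  have "p B = - (A * B)" "p 1 = - A"
    by (simp_all add: p_def power2_eq_square algebra_simps)
  then have pc: "p c < 0" using assms by (auto simp: c_def min_def)
  have p0: "p 0 > 0" using assms by (simp add: p_def)
  have "continuous_on {0..c} p" unfolding p_def by (intro continuous_intros)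
  then obtain t where t: "0 \<le> t" "t \<le> c" "p t = 0"
    using IVT2'[of p c 0 0] pc p0 c by auto
  then have t': "t \<in> {0<..<c}" using p0 pc by (cases "t = 0"; cases "t = c") auto
  \<comment> \<open>Two distinct roots \<open>s\<close> and \<open>t\<close> would have sum
    \<open>1 + A + B\<close>, hence \<open>p c = (c - t) * (c - s)\<close>, which is positive if
    both lie below \<open>c\<close>.\<close>
  have "s = t" if s: "s \<in> {0<..<c}" "p s = 0" for s
  proof (rule ccontr)
    assume "s \<noteq> t"
    have "(s - t) * (s + t - (1 + A + B)) = p s - p t"
      by (simp add: p_def power2_eq_square algebra_simps)
    then have "1 + A + B = s + t" using s t \<open>s \<noteq> t\<close> by simp
    moreover have "(c - t) * (c + t - (1 + A + B)) = p c - p t"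
      by (simp add: p_def power2_eq_square algebra_simps)
    ultimately have "(c - t) * (c + t - (s + t)) = p c" using t by simp
    then have "(c - t) * (c - s) = p c" by simp
    moreover have "(c - t) * (c - s) > 0" using s t' by simp
    ultimately show False using pc by simp
  qed
  with t t' show ?thesis unfolding p_def c_def by blast
qed

text \<open>The value of \<open>x\<close> is what makes the first summand equal to
  \<open>1 - \<psi>\<close>. That the second one equals \<open>\<psi>\<close> is then the quadratic
  equation with denominators cleared.\<close>

lemma saddle_point:
  fixes \<rho> F1 F2 \<psi> :: real
  assumes rho: "0 < \<rho>" "\<rho> < 1" and F: "F1 > 0" and psi: "\<psi> < 1"
    and eq: "\<psi>\<^sup>2 - \<psi> * (1 + 1 / (1 - \<rho>) * F1 + \<rho> / (1 - \<rho>) * F2) + \<rho> / (1 - \<rho>) * F2 = 0"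
  defines "x \<equiv> (1 - \<psi>) / (F1 + 1 - \<psi>)"
  shows "0 < x" "x < 1" "F1 * (x / (1 - x)) + F2 * (\<rho> * x / (1 - \<rho> * x)) = 1"
proof -
  show x: "0 < x" "x < 1" using F psi by (auto simp: x_def)
  define d where "d = F1 + (1 - \<rho>) * (1 - \<psi>)"
  have d: "d > 0" using F psi rho by (simp add: d_def add_pos_pos)
  have "1 - x = F1 / (F1 + 1 - \<psi>)" "1 - \<rho> * x = d / (F1 + 1 - \<psi>)"
    using F psi by (simp_all add: x_def d_def field_simps)
  then have q: "x / (1 - x) = (1 - \<psi>) / F1" "\<rho> * x / (1 - \<rho> * x) = \<rho> * (1 - \<psi>) / d"
    using F psi by (simp_all add: x_def)
  \<comment> \<open>Naming the reciprocal of \<open>1 - \<rho>\<close> turns the identity below into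
    a polynomial one, within reach of \<open>algebra\<close>.\<close>
  define u where "u = 1 / (1 - \<rho>)"
  have u: "(1 - \<rho>) * u = 1" "\<rho> / (1 - \<rho>) = \<rho> * u"
    using rho by (simp_all add: u_def)
  have "(1 - \<rho>) * (\<psi>\<^sup>2 - \<psi>) - \<psi> * (F1 + \<rho> * F2) + \<rho> * F2
      = (1 - \<rho>) * (\<psi>\<^sup>2 - \<psi> * (1 + 1 / (1 - \<rho>) * F1 + \<rho> / (1 - \<rho>) * F2) + \<rho> / (1 - \<rho>) * F2)"
    unfolding u(2) u_def[symmetric] using u(1) by algebra
  then have "F2 * (\<rho> * (1 - \<psi>)) = \<psi> * d"
    unfolding eq by (simp add: d_def power2_eq_square algebra_simps)
  then have "F2 * (\<rho> * (1 - \<psi>) / d) = \<psi>" using d by (simp add: field_simps)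
  then show "F1 * (x / (1 - x)) + F2 * (\<rho> * x / (1 - \<rho> * x)) = 1"
    unfolding q using F by simp
qed

section \<open>Limit law of the filaments and vanishing share of free monomers\<close>

theorem corollary2:
  fixes f f1 f2 :: "nat \<Rightarrow> nat"
    and \<kappa> :: "nat \<Rightarrow> nat \<Rightarrow> real"
    and \<kappa>1 \<rho>f F1 F2 :: real
    and \<Omega> :: "nat \<Rightarrow> 'a measure"
    and L :: "nat \<Rightarrow> nat \<Rightarrow> 'a \<Rightarrow> nat"
  assumes L: "\<And>m. filament_vector m (f m) (\<kappa> m) (\<Omega> m) (L m)"
    and f1: "\<And>m. f1 m \<le> f m"
    and f2: "\<And>m. f2 m = f m - f1 m"
    and rho: "0 < \<rho>f" "\<rho>f < 1"
    and kappa1: "0 < \<kappa>1"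
    and kappa_le: "\<And>m i. i \<in> {1..f1 m} \<Longrightarrow> \<kappa> m i = \<kappa>1"
    and kappa_gt: "\<And>m i. i \<in> {f1 m + 1..f m} \<Longrightarrow> \<kappa> m i = \<kappa>1 / \<rho>f"
    and lim1: "(\<lambda>m. real (f1 m) / real m) \<longlonglongrightarrow> F1"
    and lim2: "(\<lambda>m. real (f2 m) / real m) \<longlonglongrightarrow> F2"
    and F: "F1 + F2 > F1" "F1 > 0"
  shows "(\<exists>!\<psi>. \<psi> \<in> {0<..<min (F2 * (\<rho>f / (1 - \<rho>f))) 1} \<and>
             \<psi>\<^sup>2 - \<psi> * (1 + 1 / (1 - \<rho>f) * F1 + \<rho>f / (1 - \<rho>f) * F2) + \<rho>f / (1 - \<rho>f) * F2 = 0) \<and>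
         (\<forall>\<psi>. \<psi> \<in> {0<..<min (F2 * (\<rho>f / (1 - \<rho>f))) 1} \<and>
             \<psi>\<^sup>2 - \<psi> * (1 + 1 / (1 - \<rho>f) * F1 + \<rho>f / (1 - \<rho>f) * F2) + \<rho>f / (1 - \<rho>f) * F2 = 0 \<longrightarrow>
           (\<forall>i r.
              ((\<forall>\<^sub>F m in sequentially. i m \<in> {1..f1 m}) \<or>
               (\<forall>\<^sub>F m in sequentially. i m \<in> {f1 m + 1..f m})) \<and>
              (\<forall>\<^sub>F m in sequentially. rel_const (\<kappa> m) (i m) = r) \<longrightarrow>
              (\<forall>l::nat. (\<lambda>m. measure (\<Omega> m) {\<omega> \<in> space (\<Omega> m). L m (i m) \<omega> \<ge> l})
                 \<longlonglongrightarrow> (r * ((1 - \<psi>) / (F1 + 1 - \<psi>))) ^ l))) \<and>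
         tendsto_in_prob \<Omega> (\<lambda>m \<omega>. free_monomers m (f m) (L m) \<omega> / real m) 0"
proof (intro conjI allI impI)
  define A where "A = 1 / (1 - \<rho>f) * F1"
  define B where "B = \<rho>f / (1 - \<rho>f) * F2"
  let ?Q = "\<lambda>\<psi>. \<psi> \<in> {0<..<min (F2 * (\<rho>f / (1 - \<rho>f))) 1} \<and>
      \<psi>\<^sup>2 - \<psi> * (1 + 1 / (1 - \<rho>f) * F1 + \<rho>f / (1 - \<rho>f) * F2) + \<rho>f / (1 - \<rho>f) * F2 = 0"
  let ?Z = "\<lambda>m. partition_fun (f m) (\<kappa> m)"
  have F2: "F2 > 0" using F by simp
  have f: "f m = f1 m + f2 m" for m using f1[of m] f2[of m] by simp
  have AB: "A > 0" "B > 0" using rho F F2 by (simp_all add: A_def B_def)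
  show ex: "\<exists>!\<psi>. ?Q \<psi>"
    using quadratic_unique_root[OF AB] by (simp only: A_def B_def mult.commute[of F2])
  have kappa_gt': "\<kappa> m i = \<kappa>1 / \<rho>f" if "i \<in> {f1 m + 1..f1 m + f2 m}" for m i
    using kappa_gt that by (simp only: f)
  have pos: "\<kappa> m i > 0" if "i \<in> {1..f m}" for m i
    using that kappa_le[of i m] kappa_gt[of i m] rho kappa1 by (cases "i \<le> f1 m") auto
  have Z: "?Z m n > 0" for m n by (rule partition_fun_pos) (rule pos)
  have ratio: "(\<lambda>m. ?Z m (m - Suc s) / ?Z m (m - s)) \<longlonglongrightarrow> \<kappa>1 * ((1 - \<psi>) / (F1 + 1 - \<psi>))"
    if "?Q \<psi>" for \<psi> s
  proof -
    have "\<psi> < 1" using that by simp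
    note sp = saddle_point[OF rho F(2) this conjunct2[OF that]]
    show ?thesis
      unfolding f by (rule partition_fun_ratio_limit[OF rho kappa1 kappa_le kappa_gt' lim1 lim2 F(2) F2 sp])
  qed
  \<comment> \<open>\<open>rel_const\<close> refers to filament 1, whose constant is known to be
    \<open>\<kappa>1\<close> once the first group is nonempty.\<close>
  have f1_ge: "\<forall>\<^sub>F m in sequentially. f1 m \<ge> 1"
    using order_tendstoD(1)[OF lim1 F(2)]
    by eventually_elim (auto simp: Suc_le_eq intro: gr0I)
  show "(\<lambda>m. measure (\<Omega> m) {\<omega> \<in> space (\<Omega> m). l \<le> L m (i m) \<omega>})
      \<longlonglongrightarrow> (r * ((1 - \<psi>) / (F1 + 1 - \<psi>))) ^ l"
    if \<psi>: "?Q \<psi>"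
      and ir: "((\<forall>\<^sub>F m in sequentially. i m \<in> {1..f1 m}) \<or>
               (\<forall>\<^sub>F m in sequentially. i m \<in> {f1 m + 1..f m})) \<and>
              (\<forall>\<^sub>F m in sequentially. rel_const (\<kappa> m) (i m) = r)" for \<psi> i r l
  proof -
    have i: "\<forall>\<^sub>F m in sequentially. i m \<in> {1..f m}"
    proof -
      have "i m \<in> {1..f m}" if "i m \<in> {1..f1 m} \<or> i m \<in> {f1 m + 1..f m}" for m
        using that f1[of m] by auto
      then show ?thesis using ir by (blast intro: eventually_mono)
    qed
    have r: "\<forall>\<^sub>F m in sequentially. rel_const (\<kappa> m) (i m) = r" using ir by blast
    let ?x = "(1 - \<psi>) / (F1 + 1 - \<psi>)"
    have "(\<lambda>m. ?Z m (m - l) / ?Z m m) \<longlonglongrightarrow> (\<kappa>1 * ?x) ^ l"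
      using Z by (intro tendsto_power_ratio[OF _ ratio[OF \<psi>]]) (auto simp: less_imp_neq[symmetric])
    then have "(\<lambda>m. (r / \<kappa>1) ^ l * (?Z m (m - l) / ?Z m m)) \<longlonglongrightarrow> (r / \<kappa>1) ^ l * (\<kappa>1 * ?x) ^ l"
      by (intro tendsto_intros)
    moreover have "(r / \<kappa>1) ^ l * (\<kappa>1 * ?x) ^ l = (r * ?x) ^ l"
      using kappa1 by (simp flip: power_mult_distrib)
    \<comment> \<open>Eventually \<open>r / \<kappa>1\<close> is the reciprocal of the constant of
      filament \<open>i m\<close>, so the factor turns the quotient of partition functions into the
      tail probability.\<close>
    moreover have "\<forall>\<^sub>F m in sequentially. (r / \<kappa>1) ^ l * (?Z m (m - l) / ?Z m m)
        = measure (\<Omega> m) {\<omega> \<in> space (\<Omega> m). l \<le> L m (i m) \<omega>}"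
      using i r f1_ge eventually_ge_at_top[of l]
    proof eventually_elim
      case (elim m)
      have "r / \<kappa>1 = inverse (\<kappa> m (i m))"
        using elim kappa_le[of 1 m] kappa1 by (auto simp: rel_const_def field_simps)
      then show ?case
        using prob_filament_ge[OF L pos elim(1,4)] by (simp add: power_inverse)
    qed
    ultimately show ?thesis using Lim_transform_eventually by fastforce
  qed
  show "tendsto_in_prob \<Omega> (\<lambda>m \<omega>. free_monomers m (f m) (L m) \<omega> / real m) 0"
    unfolding tendsto_in_prob_def
  proof (intro allI impI)
    fix \<epsilon> :: real assume e: "\<epsilon> > 0"
    obtain \<psi> where "?Q \<psi>" using ex by blast
    from ratio[OF this, of 0]
    \<comment> \<open>Markov's bound at threshold \<open>\<epsilon> * real m\<close> is a convergent
      ratio divided by \<open>\<epsilon> * real m\<close>, so the factor \<open>1 / real m\<close>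
      forces the limit 0.\<close>
    have "(\<lambda>m. ?Z m (m - 1) / ?Z m m / \<epsilon> * (1 / real m))
        \<longlonglongrightarrow> \<kappa>1 * ((1 - \<psi>) / (F1 + 1 - \<psi>)) / \<epsilon> * 0"
      using e by (intro tendsto_intros lim_const_over_n) auto
    then have lim: "(\<lambda>m. ?Z m (m - 1) / ?Z m m / \<epsilon> * (1 / real m)) \<longlonglongrightarrow> 0" by simp
    show "(\<lambda>m. measure (\<Omega> m) {\<omega> \<in> space (\<Omega> m).
        \<epsilon> < \<bar>free_monomers m (f m) (L m) \<omega> / real m - 0\<bar>}) \<longlonglongrightarrow> 0"
    proof (rule tendsto_sandwich[OF _ _ tendsto_const lim])
      show "\<forall>\<^sub>F m in sequentially. measure (\<Omega> m) {\<omega> \<in> space (\<Omega> m).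
          \<epsilon> < \<bar>free_monomers m (f m) (L m) \<omega> / real m - 0\<bar>} \<le> ?Z m (m - 1) / ?Z m m / \<epsilon> * (1 / real m)"
        using eventually_gt_at_top[of 0]
      proof eventually_elim
        case (elim m)
        then obtain n where n: "m = Suc n" using gr0_implies_Suc by blast
        have "measure (\<Omega> m) {\<omega> \<in> space (\<Omega> m). \<bar>free_monomers (Suc n) (f m) (L m) \<omega>\<bar> > \<epsilon> * real m}
            \<le> ?Z m n / ?Z m (Suc n) / (\<epsilon> * real m)"
          using e elim L[of m] by (intro prob_free_monomers_gt pos) (simp_all add: n)
        moreover have "\<epsilon> < \<bar>y / real m - 0\<bar> \<longleftrightarrow> \<bar>y\<bar> > \<epsilon> * real m" for y
          using elim by (simp add: less_divide_eq)
        ultimately show ?case by (simp add: n)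
      qed
    qed simp
  qed
qed

end
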